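(* Let $\mathcal C$ be a finitely complete category with a factorization system $(\mathcal E,\mathcal M)$. The underlying functor $\overline{(-)}:\mathcal C\to\mathbf{Cat}$ preserves the terminal object, sets, slices and discrete fibrations. That is: $\overline 1$ is the terminal category; if $S$ is an internal set of $\mathcal C$ then $\overline S$ is a discrete category; for every point $x:1\to X$ the functor $\overline{\downarrow x}:\overline{X/x}\to\overline X$ is (up to isomorphism over $\overline X$) the usual slice projection $\overline X/x\to\overline X$; and if $f:X\to Y$ is in $\mathcal M$ then $\overline f:\overline X\to\overline Y$ is a discrete fibration of categories.
   Context: A factorization system $(\mathcal E,\mathcal M)$ is an orthogonal one: both classes contain the isomorphisms and are closed under composition, every map factors as $m\circ e$ with $e\in\mathcal E$, $m\in\mathcal M$, and every $e\in\mathcal E$ is orthogonal (unique diagonal fill-ins) to every $m\in\mathcal M$. Maps in $\mathcal E$ are called final, maps in $\mathcal M$ discrete fibrations; a factorization of every map is chosen. An internal set is an object $S$ with $S\to 1$ in $\mathcal M$. A point of $X$ is a map $x:1\to X$; its chosen factorization is $x=(\downarrow x)\circ e_x$ with $e_x:1\to X/x$ final and $\downarrow x:X/x\to X$ in $\mathcal M$; $X/x$ is the slice of $X$ at $x$. An arrow $\alpha:x\to y$ of $X$ is a map $\alpha:1\to X/y$ with $(\downarrow y)\circ\alpha=x$; by orthogonality it corresponds to a unique map $\widehat\alpha:X/x\to X/y$ over $X$ with $\widehat\alpha\circ e_x=\alpha$. The underlying category $\overline X$ has the points of $X$ as objects, the arrows $x\to y$ as morphisms, identities $e_x$, and composition $\beta\circ\alpha:=\widehat\beta\circ\alpha$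 (so $\overline X(x,y)\cong(\mathcal C/X)(X/x,X/y)$). For $f:X\to Y$ and a point $x$ of $X$, the arrow map $e_{f,x}:X/x\to Y/fx$ is the unique final map with $(\downarrow fx)\circ e_{f,x}=f\circ(\downarrow x)$ and $e_{f,x}\circ e_x=e_{fx}$. The functor $\overline f:\overline X\to\overline Y$ sends $x$ to $fx$ and $\alpha:x\to x'$ to $e_{f,x'}\circ\alpha:fx\to fx'$; this makes $\overline{(-)}$ a functor $\mathcal C\to\mathbf{Cat}$. *)

theory Defs
  imports Main
begin

section \<open>Categories and functors\<close>

record ('o, 'm) cat =
  Ob :: "'o set"
  Ar :: "'m set"
  Dom :: "'m \<Rightarrow> 'o"
  Cod :: "'m \<Rightarrow> 'o"
  Idt :: "'o \<Rightarrow> 'm"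
  Comp :: "'m \<Rightarrow> 'm \<Rightarrow> 'm"  (infixr "\<cdot>\<index>" 75)

definition Hom :: "('o, 'm, 'z) cat_scheme \<Rightarrow> 'o \<Rightarrow> 'o \<Rightarrow> 'm set" where
  "Hom C a b = {f \<in> Ar C. Dom C f = a \<and> Cod C f = b}"

locale category =
  fixes C :: "('o, 'm, 'z) cat_scheme" (structure)
  assumes dom_ob: "f \<in> Ar C \<Longrightarrow> Dom C f \<in> Ob C"
    and cod_ob: "f \<in> Ar C \<Longrightarrow> Cod C f \<in> Ob C"
    and id_hom: "a \<in> Ob C \<Longrightarrow> Idt C a \<in> Hom C a a"
    and comp_hom: "f \<in> Hom C a b \<Longrightarrow> g \<in> Hom C b c \<Longrightarrow> g \<cdot> f \<in> Hom C a c"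
    and id_left: "f \<in> Hom C a b \<Longrightarrow> Idt C b \<cdot> f = f"
    and id_right: "f \<in> Hom C a b \<Longrightarrow> f \<cdot> Idt C a = f"
    and assoc: "f \<in> Hom C a b \<Longrightarrow> g \<in> Hom C b c \<Longrightarrow> h \<in> Hom C c d
                  \<Longrightarrow> (h \<cdot> g) \<cdot> f = h \<cdot> (g \<cdot> f)"

definition isomorphisms :: "('o, 'm, 'z) cat_scheme \<Rightarrow> 'm set" where
  "isomorphisms C = {f \<in> Ar C. \<exists>g \<in> Hom C (Cod C f) (Dom C f).
     g \<cdot>\<^bsub>C\<^esub> f = Idt C (Dom C f) \<and> f \<cdot>\<^bsub>C\<^esub> g = Idt C (Cod C f)}"

definition terminal_object :: "('o, 'm, 'z) cat_scheme \<Rightarrow> 'o \<Rightarrow> bool" where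
  "terminal_object C t \<longleftrightarrow> t \<in> Ob C \<and> (\<forall>a \<in> Ob C. \<exists>!f. f \<in> Hom C a t)"

record ('o1, 'm1, 'o2, 'm2) cat_functor =
  fob :: "'o1 \<Rightarrow> 'o2"
  far :: "'m1 \<Rightarrow> 'm2"

locale is_functor = dom: category A + cod: category B
  for A :: "('o1, 'm1, 'y) cat_scheme" and B :: "('o2, 'm2, 'z) cat_scheme"
    and F :: "('o1, 'm1, 'o2, 'm2) cat_functor" +
  assumes fob_ob: "a \<in> Ob A \<Longrightarrow> fob F a \<in> Ob B"
    and far_hom: "f \<in> Hom A a b \<Longrightarrow> far F f \<in> Hom B (fob F a) (fob F b)"
    and far_id: "a \<in> Ob A \<Longrightarrow> far F (Idt A a) = Idt B (fob F a)"
    and far_comp: "f \<in> Hom A a b \<Longrightarrow> g \<in> Hom A b c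
                     \<Longrightarrow> far F (g \<cdot>\<^bsub>A\<^esub> f) = far F g \<cdot>\<^bsub>B\<^esub> far F f"

definition functor_id :: "('o, 'm, 'o, 'm) cat_functor" where
  "functor_id = \<lparr>fob = (\<lambda>a. a), far = (\<lambda>f. f)\<rparr>"

definition functor_comp ::
  "('o2, 'm2, 'o3, 'm3) cat_functor \<Rightarrow> ('o1, 'm1, 'o2, 'm2) cat_functor
     \<Rightarrow> ('o1, 'm1, 'o3, 'm3) cat_functor" where
  "functor_comp G F = \<lparr>fob = fob G \<circ> fob F, far = far G \<circ> far F\<rparr>"

text \<open>
  The components of a functor are total functions, so equality of functors means agreement
  on the objects and arrows of the source category.
\<close>

definition functor_eq ::
  "('o1, 'm1, 'y) cat_scheme \<Rightarrow> ('o1, 'm1, 'o2, 'm2) cat_functor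
     \<Rightarrow> ('o1, 'm1, 'o2, 'm2) cat_functor \<Rightarrow> bool" where
  "functor_eq A F G \<longleftrightarrow> (\<forall>a \<in> Ob A. fob F a = fob G a) \<and> (\<forall>f \<in> Ar A. far F f = far G f)"

definition category_isomorphism ::
  "('o1, 'm1, 'y) cat_scheme \<Rightarrow> ('o2, 'm2, 'z) cat_scheme
     \<Rightarrow> ('o1, 'm1, 'o2, 'm2) cat_functor \<Rightarrow> bool" where
  "category_isomorphism A B F \<longleftrightarrow> is_functor A B F \<and>
     (\<exists>G. is_functor B A G \<and> functor_eq A (functor_comp G F) functor_id
        \<and> functor_eq B (functor_comp F G) functor_id)"

definition terminal_category :: "('o, 'm, 'z) cat_scheme \<Rightarrow> bool" where
  "terminal_category A \<longleftrightarrow> category A \<and> (\<exists>!a. a \<in> Ob A) \<and> (\<exists>!f. f \<in> Ar A)"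

definition discrete_category :: "('o, 'm, 'z) cat_scheme \<Rightarrow> bool" where
  "discrete_category A \<longleftrightarrow> category A \<and> (\<forall>f \<in> Ar A. \<exists>a \<in> Ob A. f = Idt A a)"

definition discrete_fibration ::
  "('o1, 'm1, 'y) cat_scheme \<Rightarrow> ('o2, 'm2, 'z) cat_scheme
     \<Rightarrow> ('o1, 'm1, 'o2, 'm2) cat_functor \<Rightarrow> bool" where
  "discrete_fibration A B F \<longleftrightarrow> is_functor A B F \<and>
     (\<forall>a \<in> Ob A. \<forall>g \<in> Ar B. Cod B g = fob F a
        \<longrightarrow> (\<exists>!h. h \<in> Ar A \<and> Cod A h = a \<and> far F h = g))"

text \<open>
  Objects of \<open>A/a\<close> are the arrows with codomain \<open>a\<close>; an arrow of \<open>A/a\<close> is a triple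
  \<open>(g, h, k)\<close> with \<open>h\<close> a map over \<open>a\<close> from \<open>g\<close> to \<open>k\<close>.
\<close>

definition slice_category :: "('o, 'm, 'z) cat_scheme \<Rightarrow> 'o \<Rightarrow> ('m, 'm \<times> 'm \<times> 'm) cat" where
  "slice_category A a =
     \<lparr>Ob = {g \<in> Ar A. Cod A g = a},
      Ar = {(g, h, k). g \<in> Ar A \<and> Cod A g = a \<and> k \<in> Ar A \<and> Cod A k = a
              \<and> h \<in> Hom A (Dom A g) (Dom A k) \<and> k \<cdot>\<^bsub>A\<^esub> h = g},
      Dom = (\<lambda>(g, h, k). g),
      Cod = (\<lambda>(g, h, k). k),
      Idt = (\<lambda>g. (g, Idt A (Dom A g), g)),
      Comp = (\<lambda>(k, h', l) (g, h, k'). (g, h' \<cdot>\<^bsub>A\<^esub> h, l))\<rparr>"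

definition slice_projection ::
  "('o, 'm, 'z) cat_scheme \<Rightarrow> ('m, 'm \<times> 'm \<times> 'm, 'o, 'm) cat_functor" where
  "slice_projection A = \<lparr>fob = Dom A, far = (\<lambda>(g, h, k). h)\<rparr>"


section \<open>Finite limits\<close>

definition cone ::
  "('i, 'j, 'y) cat_scheme \<Rightarrow> ('o, 'm, 'z) cat_scheme \<Rightarrow> ('i, 'j, 'o, 'm) cat_functor
     \<Rightarrow> 'o \<Rightarrow> ('i \<Rightarrow> 'm) \<Rightarrow> bool" where
  "cone J C D l p \<longleftrightarrow> l \<in> Ob C \<and> (\<forall>i \<in> Ob J. p i \<in> Hom C l (fob D i))
     \<and> (\<forall>u \<in> Ar J. far D u \<cdot>\<^bsub>C\<^esub> p (Dom J u) = p (Cod J u))"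

definition limit_cone ::
  "('i, 'j, 'y) cat_scheme \<Rightarrow> ('o, 'm, 'z) cat_scheme \<Rightarrow> ('i, 'j, 'o, 'm) cat_functor
     \<Rightarrow> 'o \<Rightarrow> ('i \<Rightarrow> 'm) \<Rightarrow> bool" where
  "limit_cone J C D l p \<longleftrightarrow> cone J C D l p \<and>
     (\<forall>l' p'. cone J C D l' p'
        \<longrightarrow> (\<exists>!h. h \<in> Hom C l' l \<and> (\<forall>i \<in> Ob J. p i \<cdot>\<^bsub>C\<^esub> h = p' i)))"

text \<open>
  Index categories have natural numbers as objects and arrows; every finite category is
  isomorphic to one of this kind.
\<close>

definition finitely_complete :: "('o, 'm, 'z) cat_scheme \<Rightarrow> bool" where
  "finitely_complete C \<longleftrightarrow>
     (\<forall>(J :: (nat, nat) cat) D. finite (Ob J) \<and> finite (Ar J) \<and> is_functor J C D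
        \<longrightarrow> (\<exists>l p. limit_cone J C D l p))"


section \<open>Factorization systems\<close>

definition orthogonal :: "('o, 'm, 'z) cat_scheme \<Rightarrow> 'm \<Rightarrow> 'm \<Rightarrow> bool" where
  "orthogonal C e m \<longleftrightarrow>
     (\<forall>u \<in> Hom C (Dom C e) (Dom C m). \<forall>v \<in> Hom C (Cod C e) (Cod C m).
        m \<cdot>\<^bsub>C\<^esub> u = v \<cdot>\<^bsub>C\<^esub> e
          \<longrightarrow> (\<exists>!d. d \<in> Hom C (Cod C e) (Dom C m) \<and> d \<cdot>\<^bsub>C\<^esub> e = u \<and> m \<cdot>\<^bsub>C\<^esub> d = v))"

definition closed_under_comp :: "('o, 'm, 'z) cat_scheme \<Rightarrow> 'm set \<Rightarrow> bool" where
  "closed_under_comp C K \<longleftrightarrow>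
     (\<forall>f \<in> K. \<forall>g \<in> K. Cod C f = Dom C g \<longrightarrow> g \<cdot>\<^bsub>C\<^esub> f \<in> K)"

definition factorization_system :: "('o, 'm, 'z) cat_scheme \<Rightarrow> 'm set \<Rightarrow> 'm set \<Rightarrow> bool" where
  "factorization_system C E M \<longleftrightarrow>
     E \<subseteq> Ar C \<and> M \<subseteq> Ar C
     \<and> isomorphisms C \<subseteq> E \<and> isomorphisms C \<subseteq> M
     \<and> closed_under_comp C E \<and> closed_under_comp C M
     \<and> (\<forall>f \<in> Ar C. \<exists>e \<in> E. \<exists>m \<in> M. Dom C e = Dom C f \<and> Cod C m = Cod C f
          \<and> Cod C e = Dom C m \<and> m \<cdot>\<^bsub>C\<^esub> e = f)
     \<and> (\<forall>e \<in> E. \<forall>m \<in> M. orthogonal C e m)"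

text \<open>
  The chosen data: a terminal object, the classes of final maps and of discrete fibrations,
  and the two parts \<open>f = mpart f \<cdot> epart f\<close> of the chosen factorization of each map.
\<close>

record ('o, 'm) fcat = "('o, 'm) cat" +
  trm :: 'o
  final :: "'m set"
  dfib :: "'m set"
  epart :: "'m \<Rightarrow> 'm"
  mpart :: "'m \<Rightarrow> 'm"

locale fc_category = category C for C :: "('o, 'm, 'z) fcat_scheme" (structure) +
  assumes finitely_complete: "finitely_complete C"
    and trm: "terminal_object C (trm C)"
    and factorization_system: "factorization_system C (final C) (dfib C)"
    and epart: "f \<in> Ar C \<Longrightarrow> epart C f \<in> final C \<and> Dom C (epart C f) = Dom C f"
    and mpart: "f \<in> Ar C \<Longrightarrow> mpart C f \<in> dfib C \<and> Cod C (mpart C f) = Cod C f"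
    and parts: "f \<in> Ar C \<Longrightarrow> Cod C (epart C f) = Dom C (mpart C f)
                  \<and> mpart C f \<cdot> epart C f = f"


section \<open>Points, slices and the underlying functor\<close>

definition internal_set :: "('o, 'm, 'z) fcat_scheme \<Rightarrow> 'o \<Rightarrow> bool" where
  "internal_set C S \<longleftrightarrow> S \<in> Ob C \<and> (\<exists>f \<in> Hom C S (trm C). f \<in> dfib C)"

definition points :: "('o, 'm, 'z) fcat_scheme \<Rightarrow> 'o \<Rightarrow> 'm set" where
  "points C X = Hom C (trm C) X"

text \<open>
  For a point \<open>x\<close> of \<open>X\<close> the map \<open>\<down>x : X/x \<rightarrow> X\<close> is \<open>mpart C x\<close> and the
  final point \<open>e_x\<close> of \<open>X/x\<close> is \<open>epart C x\<close>.
\<close>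

definition slice :: "('o, 'm, 'z) fcat_scheme \<Rightarrow> 'm \<Rightarrow> 'o" where
  "slice C x = Dom C (mpart C x)"

definition arrows :: "('o, 'm, 'z) fcat_scheme \<Rightarrow> 'm \<Rightarrow> 'm \<Rightarrow> 'm set" where
  "arrows C x y = {\<alpha> \<in> points C (slice C y). mpart C y \<cdot>\<^bsub>C\<^esub> \<alpha> = x}"

definition hat :: "('o, 'm, 'z) fcat_scheme \<Rightarrow> 'm \<Rightarrow> 'm \<Rightarrow> 'm \<Rightarrow> 'm" where
  "hat C x \<alpha> y = (THE h. h \<in> Hom C (slice C x) (slice C y)
     \<and> mpart C y \<cdot>\<^bsub>C\<^esub> h = mpart C x \<and> h \<cdot>\<^bsub>C\<^esub> epart C x = \<alpha>)"

text \<open>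
  A map \<open>1 \<rightarrow> X/y\<close> does not determine the point \<open>y\<close>, as different points may have the
  same object as their slice; so the arrows of the underlying category carry their source
  and target.
\<close>

definition underlying :: "('o, 'm, 'z) fcat_scheme \<Rightarrow> 'o \<Rightarrow> ('m, 'm \<times> 'm \<times> 'm) cat" where
  "underlying C X =
     \<lparr>Ob = points C X,
      Ar = {(x, \<alpha>, y). x \<in> points C X \<and> y \<in> points C X \<and> \<alpha> \<in> arrows C x y},
      Dom = (\<lambda>(x, \<alpha>, y). x),
      Cod = (\<lambda>(x, \<alpha>, y). y),
      Idt = (\<lambda>x. (x, epart C x, x)),
      Comp = (\<lambda>(y, \<beta>, z) (x, \<alpha>, y'). (x, hat C y \<beta> z \<cdot>\<^bsub>C\<^esub> \<alpha>, z))\<rparr>"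

definition arrow_map :: "('o, 'm, 'z) fcat_scheme \<Rightarrow> 'm \<Rightarrow> 'm \<Rightarrow> 'm" where
  "arrow_map C f x = (THE e. e \<in> final C \<and> e \<in> Hom C (slice C x) (slice C (f \<cdot>\<^bsub>C\<^esub> x))
     \<and> mpart C (f \<cdot>\<^bsub>C\<^esub> x) \<cdot>\<^bsub>C\<^esub> e = f \<cdot>\<^bsub>C\<^esub> mpart C x
     \<and> e \<cdot>\<^bsub>C\<^esub> epart C x = epart C (f \<cdot>\<^bsub>C\<^esub> x))"

definition underlying_functor ::
  "('o, 'm, 'z) fcat_scheme \<Rightarrow> 'm \<Rightarrow> ('m, 'm \<times> 'm \<times> 'm, 'm, 'm \<times> 'm \<times> 'm) cat_functor" where
  "underlying_functor C f =
     \<lparr>fob = (\<lambda>x. f \<cdot>\<^bsub>C\<^esub> x),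
      far = (\<lambda>(x, \<alpha>, x'). (f \<cdot>\<^bsub>C\<^esub> x, arrow_map C f x' \<cdot>\<^bsub>C\<^esub> \<alpha>, f \<cdot>\<^bsub>C\<^esub> x'))\<rparr>"


text \<open>
  The descriptions above are well defined, and the construction is a functor into categories.
\<close>

lemma HomD: "f \<in> Hom C a b \<Longrightarrow> f \<in> Ar C \<and> Dom C f = a \<and> Cod C f = b"
  by (simp add: Hom_def)

context fc_category
begin

lemma final_comp:
  assumes "e \<in> final C" "e' \<in> final C" "e \<in> Hom C a b" "e' \<in> Hom C b c"
  shows "e' \<cdot> e \<in> final C"
  using assms factorization_system
  unfolding factorization_system_def closed_under_comp_def by (auto dest!: HomD)

lemma diagonal:
  assumes "e \<in> final C" "m \<in> dfib C" "e \<in> Hom C a b" "m \<in> Hom C c d"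
    and "u \<in> Hom C a c" "v \<in> Hom C b d" "m \<cdot> u = v \<cdot> e"
  shows "\<exists>!k. k \<in> Hom C b c \<and> k \<cdot> e = u \<and> m \<cdot> k = v"
proof -
  have "orthogonal C e m"
    using assms(1,2) factorization_system unfolding factorization_system_def by blast
  then show ?thesis
    using assms(3-) HomD[OF assms(3)] HomD[OF assms(4)] unfolding orthogonal_def by blast
qed

lemma final_cancel:
  assumes e: "e \<in> final C" "e \<in> Hom C a b" and k: "k \<in> Hom C b c" and ke: "k \<cdot> e \<in> final C"
  shows "k \<in> final C"
proof -
  define e' m n where "e' = epart C k" and "m = mpart C k" and "n = Dom C m"
  have kA: "k \<in> Ar C" "Dom C k = b" "Cod C k = c"
    using HomD[OF k] by auto
  have e'A: "e' \<in> Ar C" and mA: "m \<in> Ar C"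
    using epart[OF kA(1)] mpart[OF kA(1)] factorization_system
    unfolding factorization_system_def e'_def m_def by blast+
  have e': "e' \<in> final C" "e' \<in> Hom C b n" and m: "m \<in> dfib C" "m \<in> Hom C n c"
    and me': "m \<cdot> e' = k"
    using epart[OF kA(1)] mpart[OF kA(1)] parts[OF kA(1)] e'A mA kA
    unfolding Hom_def e'_def m_def n_def by auto
  have e'e: "e' \<cdot> e \<in> final C" "e' \<cdot> e \<in> Hom C a n"
    using final_comp e e' comp_hom by blast+
  have ke_hom: "k \<cdot> e \<in> Hom C a c"
    using comp_hom e k by blast
  have c: "c \<in> Ob C" and n: "n \<in> Ob C"
    using cod_ob dom_ob kA mA n_def by auto
  have me'e: "m \<cdot> (e' \<cdot> e) = k \<cdot> e"
    using assoc[OF e(2) e'(2) m(2)] me' by simp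
  obtain d where d: "d \<in> Hom C c n" "d \<cdot> (k \<cdot> e) = e' \<cdot> e" "m \<cdot> d = Idt C c"
    using diagonal[OF ke m(1) ke_hom m(2) e'e(2) id_hom[OF c]] me'e id_left[OF ke_hom] by auto
  have "d \<cdot> m \<in> Hom C n n \<and> (d \<cdot> m) \<cdot> (e' \<cdot> e) = e' \<cdot> e \<and> m \<cdot> (d \<cdot> m) = m"
    using comp_hom[OF m(2) d(1)] assoc[OF e'e(2) m(2) d(1)] assoc[OF m(2) d(1) m(2)]
      me'e d id_left[OF m(2)] by simp
  moreover have "Idt C n \<in> Hom C n n \<and> Idt C n \<cdot> (e' \<cdot> e) = e' \<cdot> e \<and> m \<cdot> Idt C n = m"
    using id_hom[OF n] id_left[OF e'e(2)] id_right[OF m(2)] by simp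
  ultimately have "d \<cdot> m = Idt C n"
    using diagonal[OF e'e(1) m(1) e'e(2) m(2) e'e(2) m(2)] by blast
  then have "m \<in> isomorphisms C"
    using d m(2) unfolding isomorphisms_def by (auto dest!: HomD simp: Hom_def)
  then have "m \<in> final C"
    using factorization_system unfolding factorization_system_def by blast
  then show ?thesis
    using final_comp[OF e'(1) _ e'(2) m(2)] me' by simp
qed

lemma point_parts:
  assumes "x \<in> points C X"
  shows "epart C x \<in> final C" "epart C x \<in> Hom C (trm C) (slice C x)"
    "mpart C x \<in> dfib C" "mpart C x \<in> Hom C (slice C x) X" "mpart C x \<cdot> epart C x = x"
proof -
  have xA: "x \<in> Ar C" "Dom C x = trm C" "Cod C x = X"
    using HomD[of x C] assms by (auto simp: points_def)
  have "epart C x \<in> Ar C" "mpart C x \<in> Ar C"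
    using epart[OF xA(1)] mpart[OF xA(1)] factorization_system
    unfolding factorization_system_def by blast+
  then show "epart C x \<in> final C" "epart C x \<in> Hom C (trm C) (slice C x)"
    "mpart C x \<in> dfib C" "mpart C x \<in> Hom C (slice C x) X" "mpart C x \<cdot> epart C x = x"
    using epart[OF xA(1)] mpart[OF xA(1)] parts[OF xA(1)] xA
    by (auto simp: Hom_def slice_def)
qed

lemma epart_arrow: "x \<in> points C X \<Longrightarrow> epart C x \<in> arrows C x x"
  using point_parts by (simp add: arrows_def points_def)

lemma slice_map_ex1:
  assumes "x \<in> points C X" "y \<in> points C Y" "v \<in> Hom C (slice C x) Y"
    and "\<alpha> \<in> Hom C (trm C) (slice C y)" "mpart C y \<cdot> \<alpha> = v \<cdot> epart C x"
  shows "\<exists>!h. h \<in> Hom C (slice C x) (slice C y) \<and> h \<cdot> epart C x = \<alpha> \<and> mpart C y \<cdot> h = v"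
  by (rule diagonal[OF point_parts(1)[OF assms(1)] point_parts(3)[OF assms(2)]
        point_parts(2)[OF assms(1)] point_parts(4)[OF assms(2)] assms(4,3,5)])

lemma hat_ex1:
  assumes "x \<in> points C X" "y \<in> points C X" "\<alpha> \<in> arrows C x y"
  shows "\<exists>!h. h \<in> Hom C (slice C x) (slice C y) \<and> mpart C y \<cdot> h = mpart C x
    \<and> h \<cdot> epart C x = \<alpha>"
  using slice_map_ex1[OF assms(1,2) point_parts(4)[OF assms(1)], of \<alpha>] assms(3)
    point_parts(5)[OF assms(1)]
  by (auto simp: arrows_def points_def conj_commute)

lemma hat:
  assumes "x \<in> points C X" "y \<in> points C X" "\<alpha> \<in> arrows C x y"
  shows "hat C x \<alpha> y \<in> Hom C (slice C x) (slice C y)"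
    "mpart C y \<cdot> hat C x \<alpha> y = mpart C x" "hat C x \<alpha> y \<cdot> epart C x = \<alpha>"
  using theI'[OF hat_ex1[OF assms]] unfolding hat_def by auto

lemma hat_eq:
  assumes "x \<in> points C X" "y \<in> points C X" "h \<in> Hom C (slice C x) (slice C y)"
    and "mpart C y \<cdot> h = mpart C x" "h \<cdot> epart C x = \<alpha>"
  shows "hat C x \<alpha> y = h"
proof -
  have "\<alpha> \<in> arrows C x y"
    using comp_hom[OF point_parts(2)[OF assms(1)] assms(3)] point_parts(5)[OF assms(1)]
      assoc[OF point_parts(2)[OF assms(1)] assms(3) point_parts(4)[OF assms(2)]] assms(4,5)
    by (simp add: arrows_def points_def)
  then show ?thesis
    using hat_ex1[OF assms(1,2)] hat[OF assms(1,2)] assms(3-) by blast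
qed

lemma comp_point: "f \<in> Hom C X Y \<Longrightarrow> x \<in> points C X \<Longrightarrow> f \<cdot> x \<in> points C Y"
  using comp_hom by (auto simp: points_def)

lemma arrow_map_ex1:
  assumes f: "f \<in> Hom C X Y" and x: "x \<in> points C X"
  shows "\<exists>!e. e \<in> final C \<and> e \<in> Hom C (slice C x) (slice C (f \<cdot> x))
     \<and> mpart C (f \<cdot> x) \<cdot> e = f \<cdot> mpart C x \<and> e \<cdot> epart C x = epart C (f \<cdot> x)"
proof -
  note px = point_parts[OF x] and py = point_parts[OF comp_point[OF f x]]
  have v: "f \<cdot> mpart C x \<in> Hom C (slice C x) Y"
    using comp_hom px f by blast
  have "mpart C (f \<cdot> x) \<cdot> epart C (f \<cdot> x) = (f \<cdot> mpart C x) \<cdot> epart C x"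
    using assoc[OF px(2,4) f] px py by simp
  from slice_map_ex1[OF x comp_point[OF f x] v py(2) this]
  show ?thesis
    using final_cancel px(1,2) py(1) by (smt (verit, best))
qed

lemma arrow_map:
  assumes "f \<in> Hom C X Y" "x \<in> points C X"
  shows "arrow_map C f x \<in> final C"
    "arrow_map C f x \<in> Hom C (slice C x) (slice C (f \<cdot> x))"
    "mpart C (f \<cdot> x) \<cdot> arrow_map C f x = f \<cdot> mpart C x"
    "arrow_map C f x \<cdot> epart C x = epart C (f \<cdot> x)"
  using theI'[OF arrow_map_ex1[OF assms]] unfolding arrow_map_def by auto

lemma arrow_map_eq:
  assumes f: "f \<in> Hom C X Y" and x: "x \<in> points C X"
    and h: "h \<in> Hom C (slice C x) (slice C (f \<cdot> x))"
    and "mpart C (f \<cdot> x) \<cdot> h = f \<cdot> mpart C x" "h \<cdot> epart C x = epart C (f \<cdot> x)"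
  shows "arrow_map C f x = h"
proof -
  have "h \<in> final C"
    using final_cancel[OF point_parts(1,2)[OF x] h] assms(5)
      point_parts(1)[OF comp_point[OF f x]] by simp
  then show ?thesis
    using arrow_map_ex1[OF f x] arrow_map[OF f x] assms(3-) by blast
qed

lemma Hom_underlying:
  "a \<in> Hom (underlying C X) x y \<longleftrightarrow>
     x \<in> points C X \<and> y \<in> points C X \<and> (\<exists>\<alpha> \<in> arrows C x y. a = (x, \<alpha>, y))"
  by (auto simp: Hom_def underlying_def)

lemma comp_arrow:
  assumes "x \<in> points C X" "y \<in> points C X" "z \<in> points C X"
    and "\<alpha> \<in> arrows C x y" "\<beta> \<in> arrows C y z"
  shows "hat C y \<beta> z \<cdot> \<alpha> \<in> arrows C x z"
    "hat C x (hat C y \<beta> z \<cdot> \<alpha>) z = hat C y \<beta> z \<cdot> hat C x \<alpha> y"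
proof -
  note ha = hat[OF assms(1,2,4)] and hb = hat[OF assms(2,3,5)]
  have \<alpha>: "\<alpha> \<in> Hom C (trm C) (slice C y)" "mpart C y \<cdot> \<alpha> = x"
    using assms(4) by (auto simp: arrows_def points_def)
  note p = point_parts[OF assms(1)] point_parts(4)[OF assms(3)]
  show "hat C y \<beta> z \<cdot> \<alpha> \<in> arrows C x z"
    using comp_hom[OF \<alpha>(1) hb(1)] assoc[OF \<alpha>(1) hb(1) p(6)] hb \<alpha>
    by (simp add: arrows_def points_def)
  show "hat C x (hat C y \<beta> z \<cdot> \<alpha>) z = hat C y \<beta> z \<cdot> hat C x \<alpha> y"
    using hat_eq[OF assms(1,3) comp_hom[OF ha(1) hb(1)]] assoc[OF ha(1) hb(1) p(6)]
      assoc[OF p(2) ha(1) hb(1)] ha hb by simp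
qed

lemma hat_epart: "x \<in> points C X \<Longrightarrow> hat C x (epart C x) x = Idt C (slice C x)"
  using hat_eq[of x X x "Idt C (slice C x)"] point_parts[of x X] id_left id_right id_hom
    dom_ob HomD by (smt (verit))

theorem category_underlying: "category (underlying C X)"
proof
  fix f assume "f \<in> Ar (underlying C X)"
  then show "Dom (underlying C X) f \<in> Ob (underlying C X)"
    "Cod (underlying C X) f \<in> Ob (underlying C X)"
    by (auto simp: underlying_def)
next
  fix x assume "x \<in> Ob (underlying C X)"
  then have "x \<in> points C X"
    by (simp add: underlying_def)
  with epart_arrow show "Idt (underlying C X) x \<in> Hom (underlying C X) x x"
    unfolding Hom_underlying by (simp add: underlying_def)
next
  fix f g x y z
  assume "f \<in> Hom (underlying C X) x y" "g \<in> Hom (underlying C X) y z"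
  then show "g \<cdot>\<^bsub>underlying C X\<^esub> f \<in> Hom (underlying C X) x z"
    unfolding Hom_underlying using comp_arrow by (auto simp: underlying_def)
next
  fix f x y
  assume "f \<in> Hom (underlying C X) x y"
  then obtain \<alpha> where f: "f = (x, \<alpha>, y)" and \<alpha>: "\<alpha> \<in> arrows C x y"
    and x: "x \<in> points C X" and y: "y \<in> points C X"
    unfolding Hom_underlying by blast
  have "\<alpha> \<in> Hom C (trm C) (slice C y)"
    using \<alpha> by (simp add: arrows_def points_def)
  then show "Idt (underlying C X) y \<cdot>\<^bsub>underlying C X\<^esub> f = f"
    using hat_epart[OF y] id_left by (simp add: f underlying_def)
  show "f \<cdot>\<^bsub>underlying C X\<^esub> Idt (underlying C X) x = f"
    using hat[OF x y \<alpha>] by (simp add: f underlying_def)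
next
  fix f g h w x y z
  assume "f \<in> Hom (underlying C X) w x" "g \<in> Hom (underlying C X) x y"
    "h \<in> Hom (underlying C X) y z"
  then obtain \<alpha> \<beta> \<gamma> where f: "f = (w, \<alpha>, x)" "\<alpha> \<in> arrows C w x"
    and g: "g = (x, \<beta>, y)" "\<beta> \<in> arrows C x y" and h: "h = (y, \<gamma>, z)" "\<gamma> \<in> arrows C y z"
    and w: "w \<in> points C X" and x: "x \<in> points C X"
    and y: "y \<in> points C X" and z: "z \<in> points C X"
    unfolding Hom_underlying by blast
  have "\<alpha> \<in> Hom C (trm C) (slice C x)"
    using f by (simp add: arrows_def points_def)
  then show "(h \<cdot>\<^bsub>underlying C X\<^esub> g) \<cdot>\<^bsub>underlying C X\<^esub> f
      = h \<cdot>\<^bsub>underlying C X\<^esub> (g \<cdot>\<^bsub>underlying C X\<^esub> f)"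
    using comp_arrow(2)[OF x y z g(2) h(2)] assoc[OF _ hat(1)[OF x y g(2)] hat(1)[OF y z h(2)]]
    by (simp add: f g h underlying_def)
qed

theorem is_functor_underlying:
  assumes f: "f \<in> Hom C X Y"
  shows "is_functor (underlying C X) (underlying C Y) (underlying_functor C f)"
proof -
  have arr: "arrow_map C f y \<cdot> \<alpha> \<in> arrows C (f \<cdot> x) (f \<cdot> y)"
    if "x \<in> points C X" and y: "y \<in> points C X" and "\<alpha> \<in> arrows C x y" for x y \<alpha>
  proof -
    have \<alpha>: "\<alpha> \<in> Hom C (trm C) (slice C y)" "mpart C y \<cdot> \<alpha> = x"
      using that(3) by (auto simp: arrows_def points_def)
    note am = arrow_map[OF f y]
    note py = point_parts(4)[OF y] and pfy = point_parts(4)[OF comp_point[OF f y]]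
    show ?thesis
      using comp_hom[OF \<alpha>(1) am(2)] assoc[OF \<alpha>(1) am(2) pfy] assoc[OF \<alpha>(1) py f] am(3) \<alpha>(2)
      by (simp add: arrows_def points_def)
  qed
  interpret X: category "underlying C X" by (rule category_underlying)
  interpret Y: category "underlying C Y" by (rule category_underlying)
  show ?thesis
  proof
    fix x assume "x \<in> Ob (underlying C X)"
    then have x: "x \<in> points C X" by (simp add: underlying_def)
    then show "fob (underlying_functor C f) x \<in> Ob (underlying C Y)"
      using comp_point[OF f] by (simp add: underlying_def underlying_functor_def)
    show "far (underlying_functor C f) (Idt (underlying C X) x)
        = Idt (underlying C Y) (fob (underlying_functor C f) x)"
      using arrow_map(4)[OF f x] by (simp add: underlying_def underlying_functor_def)
  next
    fix a x y assume "a \<in> Hom (underlying C X) x y"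
    then show "far (underlying_functor C f) a
        \<in> Hom (underlying C Y) (fob (underlying_functor C f) x) (fob (underlying_functor C f) y)"
      unfolding Hom_underlying using arr comp_point[OF f]
      by (auto simp: underlying_functor_def)
  next
    fix a b x y z assume "a \<in> Hom (underlying C X) x y" "b \<in> Hom (underlying C X) y z"
    then obtain \<alpha> \<beta> where a: "a = (x, \<alpha>, y)" "\<alpha> \<in> arrows C x y"
      and b: "b = (y, \<beta>, z)" "\<beta> \<in> arrows C y z"
      and x: "x \<in> points C X" and y: "y \<in> points C X" and z: "z \<in> points C X"
      unfolding Hom_underlying by blast
    note fy = comp_point[OF f y] and fz = comp_point[OF f z]
    note ay = arrow_map[OF f y] and az = arrow_map[OF f z]
    note hb = hat[OF y z b(2)] and hfb = hat[OF fy fz arr[OF y z b(2)]]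
    note py = point_parts[OF y] and pz = point_parts(4)[OF z]
    note pfz = point_parts(4)[OF fz]
    have \<alpha>: "\<alpha> \<in> Hom C (trm C) (slice C y)"
      using a by (simp add: arrows_def points_def)
    define \<beta>' where "\<beta>' = hat C (f \<cdot> y) (arrow_map C f z \<cdot> \<beta>) (f \<cdot> z)"
    have \<beta>': "\<beta>' \<in> Hom C (slice C (f \<cdot> y)) (slice C (f \<cdot> z))"
      "mpart C (f \<cdot> z) \<cdot> \<beta>' = mpart C (f \<cdot> y)"
      "\<beta>' \<cdot> epart C (f \<cdot> y) = arrow_map C f z \<cdot> \<beta>"
      using hfb unfolding \<beta>'_def by auto
    have l: "arrow_map C f z \<cdot> hat C y \<beta> z \<in> Hom C (slice C y) (slice C (f \<cdot> z))"
      "(arrow_map C f z \<cdot> hat C y \<beta> z) \<cdot> epart C y = arrow_map C f z \<cdot> \<beta>"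
      "mpart C (f \<cdot> z) \<cdot> (arrow_map C f z \<cdot> hat C y \<beta> z) = f \<cdot> mpart C y"
      using comp_hom[OF hb(1) az(2)] assoc[OF py(2) hb(1) az(2)] assoc[OF hb(1) az(2) pfz]
        assoc[OF hb(1) pz f] hb az by auto
    have r: "\<beta>' \<cdot> arrow_map C f y \<in> Hom C (slice C y) (slice C (f \<cdot> z))"
      "(\<beta>' \<cdot> arrow_map C f y) \<cdot> epart C y = arrow_map C f z \<cdot> \<beta>"
      "mpart C (f \<cdot> z) \<cdot> (\<beta>' \<cdot> arrow_map C f y) = f \<cdot> mpart C y"
      using comp_hom[OF ay(2) \<beta>'(1)] assoc[OF py(2) ay(2) \<beta>'(1)] assoc[OF ay(2) \<beta>'(1) pfz]
        \<beta>' ay by auto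
    have \<gamma>: "arrow_map C f z \<cdot> \<beta> \<in> Hom C (trm C) (slice C (f \<cdot> z))"
      using comp_hom[OF py(2) l(1)] l(2) by simp
    have sq: "mpart C (f \<cdot> z) \<cdot> (arrow_map C f z \<cdot> \<beta>) = (f \<cdot> mpart C y) \<cdot> epart C y"
      using assoc[OF py(2) l(1) pfz] l by simp
    have "arrow_map C f z \<cdot> hat C y \<beta> z = \<beta>' \<cdot> arrow_map C f y"
      using slice_map_ex1[OF y fz comp_hom[OF py(4) f] \<gamma> sq] l r by blast
    then have "arrow_map C f z \<cdot> (hat C y \<beta> z \<cdot> \<alpha>) = \<beta>' \<cdot> (arrow_map C f y \<cdot> \<alpha>)"
      using assoc[OF \<alpha> hb(1) az(2)] assoc[OF \<alpha> ay(2) \<beta>'(1)] by simp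
    then show "far (underlying_functor C f) (b \<cdot>\<^bsub>underlying C X\<^esub> a)
        = far (underlying_functor C f) b \<cdot>\<^bsub>underlying C Y\<^esub> far (underlying_functor C f) a"
      by (simp add: a b underlying_def underlying_functor_def \<beta>'_def)
  qed
qed

theorem underlying_functor_id:
  assumes "X \<in> Ob C"
  shows "functor_eq (underlying C X) (underlying_functor C (Idt C X)) functor_id"
proof -
  have i: "Idt C X \<in> Hom C X X" by (rule id_hom[OF assms])
  have ob: "Idt C X \<cdot> x = x" if "x \<in> points C X" for x
    using that id_left by (simp add: points_def)
  have am: "arrow_map C (Idt C X) x = Idt C (slice C x)" if x: "x \<in> points C X" for x
  proof (rule arrow_map_eq[OF i x])
    note p = point_parts[OF x]
    have s: "slice C x \<in> Ob C" using HomD[OF p(4)] dom_ob[of "mpart C x"] by auto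
    show "Idt C (slice C x) \<in> Hom C (slice C x) (slice C (Idt C X \<cdot> x))"
      "mpart C (Idt C X \<cdot> x) \<cdot> Idt C (slice C x) = Idt C X \<cdot> mpart C x"
      "Idt C (slice C x) \<cdot> epart C x = epart C (Idt C X \<cdot> x)"
      using id_hom[OF s] id_left[OF p(2)] id_left[OF p(4)] id_right[OF p(4)] ob[OF x] by simp_all
  qed
  show ?thesis
    using ob am id_left
    by (auto simp: functor_eq_def underlying_def underlying_functor_def functor_id_def
        arrows_def points_def)
qed

theorem underlying_functor_comp:
  assumes f: "f \<in> Hom C X Y" and g: "g \<in> Hom C Y Z"
  shows "functor_eq (underlying C X) (underlying_functor C (g \<cdot> f))
    (functor_comp (underlying_functor C g) (underlying_functor C f))"
proof -
  have ob: "(g \<cdot> f) \<cdot> x = g \<cdot> (f \<cdot> x)" if "x \<in> points C X" for x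
    using that assoc[OF _ f g] by (simp add: points_def)
  have am: "arrow_map C (g \<cdot> f) x = arrow_map C g (f \<cdot> x) \<cdot> arrow_map C f x"
    if x: "x \<in> points C X" for x
  proof (rule arrow_map_eq[OF comp_hom[OF f g] x])
    note fx = comp_point[OF f x]
    note af = arrow_map[OF f x] and ag = arrow_map[OF g fx]
    note p = point_parts[OF x] and pf = point_parts[OF fx]
      and pg = point_parts[OF comp_point[OF g fx]]
    show "arrow_map C g (f \<cdot> x) \<cdot> arrow_map C f x
        \<in> Hom C (slice C x) (slice C ((g \<cdot> f) \<cdot> x))"
      using comp_hom[OF af(2) ag(2)] ob[OF x] by simp
    show "mpart C ((g \<cdot> f) \<cdot> x) \<cdot> (arrow_map C g (f \<cdot> x) \<cdot> arrow_map C f x)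
        = (g \<cdot> f) \<cdot> mpart C x"
      using assoc[OF af(2) ag(2) pg(4)] assoc[OF af(2) pf(4) g] assoc[OF p(4) f g]
        af(3) ag(3) ob[OF x] by simp
    show "(arrow_map C g (f \<cdot> x) \<cdot> arrow_map C f x) \<cdot> epart C x = epart C ((g \<cdot> f) \<cdot> x)"
      using assoc[OF p(2) af(2) ag(2)] af(4) ag(4) ob[OF x] by simp
  qed
  have "(arrow_map C g (f \<cdot> y) \<cdot> arrow_map C f y) \<cdot> \<alpha>
      = arrow_map C g (f \<cdot> y) \<cdot> (arrow_map C f y \<cdot> \<alpha>)"
    if "y \<in> points C X" "\<alpha> \<in> arrows C x y" for x y \<alpha>
    by (rule assoc[of \<alpha> "trm C", OF _ arrow_map(2)[OF f that(1)] arrow_map(2)[OF g comp_point[OF f that(1)]]])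
      (use that(2) in \<open>simp add: arrows_def points_def\<close>)
  with ob am show ?thesis
    by (auto simp: functor_eq_def underlying_def underlying_functor_def functor_comp_def)
qed

end

end

theory Submission
  imports Defs
begin

text \<open>
  If \<open>f\<close> is a discrete fibration, so is \<open>f \<cdot> \<down>x\<close>, and \<open>fx\<close> factors both as
  \<open>\<down>fx \<cdot> e_fx\<close> and as \<open>(f \<cdot> \<down>x) \<cdot> e_x\<close>; since factorizations are unique up to
  isomorphism, the arrow map \<open>X/x \<rightarrow> Y/fx\<close> is invertible. So the arrows of \<open>Y\<close> into \<open>fx\<close>
  lift uniquely to arrows of \<open>X\<close> into \<open>x\<close>. If \<open>S\<close> is an internal set, the same
  uniqueness shows that \<open>S/y\<close> is terminal, hence that its only point is the identity of \<open>y\<close>.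
  The isomorphism for slices is the identity on the maps \<open>1 \<rightarrow> X/x\<close>, which are both the
  points of \<open>X/x\<close> and the arrows of \<open>X\<close> into \<open>x\<close>; on arrows it is bijective since
  \<open>\<down>x\<close> induces a discrete fibration.
\<close>

section \<open>Functors bijective on objects and on arrows\<close>

lemma is_functor_inverse:
  assumes F: "is_functor A B F"
    and ob: "bij_betw (fob F) (Ob A) (Ob B)" and ar: "bij_betw (far F) (Ar A) (Ar B)"
  shows "is_functor B A \<lparr>fob = inv_into (Ob A) (fob F), far = inv_into (Ar A) (far F)\<rparr>"
    (is "is_functor B A \<lparr>fob = ?g, far = ?h\<rparr>")
proof -
  interpret F: is_functor A B F by (rule F)
  have g: "?g b \<in> Ob A" "fob F (?g b) = b" if "b \<in> Ob B" for b
    using that ob bij_betw_imp_surj_on inv_into_into f_inv_into_f by metis+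
  have h: "?h f \<in> Ar A" "far F (?h f) = f" if "f \<in> Ar B" for f
    using that ar bij_betw_imp_surj_on inv_into_into f_inv_into_f by metis+
  have g_eq: "?g (fob F a) = a" if "a \<in> Ob A" for a
    using that ob bij_betw_imp_inj_on inv_into_f_f by metis
  have h_eq: "?h (far F f) = f" if "f \<in> Ar A" for f
    using that ar bij_betw_imp_inj_on inv_into_f_f by metis
  have h_hom: "?h f \<in> Hom A (?g a) (?g b)" if "f \<in> Hom B a b" for f a b
  proof -
    have f: "f \<in> Ar B" "Dom B f = a" "Cod B f = b"
      using HomD[OF that] by auto
    have "?h f \<in> Hom A (Dom A (?h f)) (Cod A (?h f))"
      using h(1)[OF f(1)] by (simp add: Hom_def)
    \<comment> \<open>Since \<open>far F\<close> sends \<open>?h f\<close> to \<open>f\<close>, the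
      endpoints of \<open>?h f\<close> are sent to \<open>a\<close> and \<open>b\<close>; as
      \<open>?g\<close> is a left inverse on objects, they are \<open>?g a\<close> and
      \<open>?g b\<close>.\<close>
    from F.far_hom[OF this] have "fob F (Dom A (?h f)) = a" "fob F (Cod A (?h f)) = b"
      using h(2)[OF f(1)] f HomD by fastforce+
    then show ?thesis
      using g_eq F.dom.dom_ob F.dom.cod_ob h(1)[OF f(1)] unfolding Hom_def by fastforce
  qed
  show ?thesis
  proof
    fix a assume a: "a \<in> Ob B"
    then show "fob \<lparr>fob = ?g, far = ?h\<rparr> a \<in> Ob A"
      using g by simp
    \<comment> \<open>Each functor law of the inverse comes from applying \<open>?h\<close> to the
      same law of \<open>F\<close>; the left inverse property then cancels
      \<open>far F\<close>.\<close>
    have "?h (far F (Idt A (?g a))) = Idt A (?g a)"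
      using h_eq F.dom.id_hom[OF g(1)[OF a]] HomD by fastforce
    then show "far \<lparr>fob = ?g, far = ?h\<rparr> (Idt B a) = Idt A (fob \<lparr>fob = ?g, far = ?h\<rparr> a)"
      using F.far_id[OF g(1)[OF a]] g(2)[OF a] by simp
  next
    fix f a b assume "f \<in> Hom B a b"
    then show "far \<lparr>fob = ?g, far = ?h\<rparr> f
        \<in> Hom A (fob \<lparr>fob = ?g, far = ?h\<rparr> a) (fob \<lparr>fob = ?g, far = ?h\<rparr> b)"
      using h_hom by simp
  next
    fix f k a b c assume f: "f \<in> Hom B a b" and k: "k \<in> Hom B b c"
    have "?h (far F (?h k \<cdot>\<^bsub>A\<^esub> ?h f)) = ?h k \<cdot>\<^bsub>A\<^esub> ?h f"
      using h_eq F.dom.comp_hom[OF h_hom[OF f] h_hom[OF k]] HomD by fastforce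
    then show "far \<lparr>fob = ?g, far = ?h\<rparr> (k \<cdot>\<^bsub>B\<^esub> f)
        = far \<lparr>fob = ?g, far = ?h\<rparr> k \<cdot>\<^bsub>A\<^esub> far \<lparr>fob = ?g, far = ?h\<rparr> f"
      using F.far_comp[OF h_hom[OF f] h_hom[OF k]] h(2) HomD[OF f] HomD[OF k] by simp
  qed
qed

text \<open>Reduces the isomorphism of slices to two bijections, so that no inverse of the
  comparison functor has to be written down.\<close>

lemma category_isomorphism_if_bij:
  assumes "is_functor A B F"
    and ob: "bij_betw (fob F) (Ob A) (Ob B)" and ar: "bij_betw (far F) (Ar A) (Ar B)"
  shows "category_isomorphism A B F"
  unfolding category_isomorphism_def
  using assms(1) is_functor_inverse[OF assms] bij_betw_inv_into_left[OF ob]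
    bij_betw_inv_into_left[OF ar] bij_betw_inv_into_right[OF ob] bij_betw_inv_into_right[OF ar]
  by (intro conjI exI[of _ "\<lparr>fob = inv_into (Ob A) (fob F), far = inv_into (Ar A) (far F)\<rparr>"])
    (simp_all add: functor_eq_def functor_comp_def functor_id_def)

section \<open>Slices of an ordinary category\<close>

lemma (in category) dom_ob_Hom: "f \<in> Hom C a b \<Longrightarrow> a \<in> Ob C"
  using dom_ob by (auto simp: Hom_def)

text \<open>Brings the triples into the form in which the category axioms are stated, with every
  component typed by \<open>Hom\<close>.\<close>

lemma (in category) Hom_slice_category:
  "t \<in> Hom (slice_category C a) g k \<longleftrightarrow>
     g \<in> Hom C (Dom C g) a \<and> k \<in> Hom C (Dom C k) a
     \<and> (\<exists>h \<in> Hom C (Dom C g) (Dom C k). k \<cdot> h = g \<and> t = (g, h, k))"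
  by (auto simp: Hom_def slice_category_def)

lemma (in category) category_slice_category: "category (slice_category C a)"
proof
  fix t assume "t \<in> Ar (slice_category C a)"
  then show "Dom (slice_category C a) t \<in> Ob (slice_category C a)"
    "Cod (slice_category C a) t \<in> Ob (slice_category C a)"
    by (auto simp: slice_category_def)
next
  fix g assume "g \<in> Ob (slice_category C a)"
  then have g: "g \<in> Hom C (Dom C g) a"
    by (simp add: slice_category_def Hom_def)
  then show "Idt (slice_category C a) g \<in> Hom (slice_category C a) g g"
    unfolding Hom_slice_category using id_hom[OF dom_ob] id_right[OF g] HomD[OF g]
    by (simp add: slice_category_def)
next
  fix s t g k l
  assume "s \<in> Hom (slice_category C a) g k" "t \<in> Hom (slice_category C a) k l"
  then obtain h h' where s: "s = (g, h, k)" "h \<in> Hom C (Dom C g) (Dom C k)" "k \<cdot> h = g"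
    and t: "t = (k, h', l)" "h' \<in> Hom C (Dom C k) (Dom C l)" "l \<cdot> h' = k"
    and g: "g \<in> Hom C (Dom C g) a" and l: "l \<in> Hom C (Dom C l) a"
    unfolding Hom_slice_category by blast
  show "t \<cdot>\<^bsub>slice_category C a\<^esub> s \<in> Hom (slice_category C a) g l"
    unfolding Hom_slice_category using comp_hom[OF s(2) t(2)] assoc[OF s(2) t(2) l] s t g l
    by (simp add: slice_category_def)
next
  fix s g k assume "s \<in> Hom (slice_category C a) g k"
  then show "Idt (slice_category C a) k \<cdot>\<^bsub>slice_category C a\<^esub> s = s"
    "s \<cdot>\<^bsub>slice_category C a\<^esub> Idt (slice_category C a) g = s"
    unfolding Hom_slice_category using id_left id_right by (auto simp: slice_category_def)
next
  fix s t u g k l m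
  assume "s \<in> Hom (slice_category C a) g k" "t \<in> Hom (slice_category C a) k l"
    "u \<in> Hom (slice_category C a) l m"
  then obtain h h' h'' where "s = (g, h, k)" "h \<in> Hom C (Dom C g) (Dom C k)"
    "t = (k, h', l)" "h' \<in> Hom C (Dom C k) (Dom C l)"
    "u = (l, h'', m)" "h'' \<in> Hom C (Dom C l) (Dom C m)"
    unfolding Hom_slice_category by blast
  then show "(u \<cdot>\<^bsub>slice_category C a\<^esub> t) \<cdot>\<^bsub>slice_category C a\<^esub> s
      = u \<cdot>\<^bsub>slice_category C a\<^esub> (t \<cdot>\<^bsub>slice_category C a\<^esub> s)"
    using assoc by (simp add: slice_category_def)
qed

section \<open>Invertible arrow maps and discrete fibrations\<close>

context fc_category
begin

lemma dfib_comp: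
  assumes "m \<in> dfib C" "n \<in> dfib C" "m \<in> Hom C a b" "n \<in> Hom C b c"
  shows "n \<cdot> m \<in> dfib C"
  using assms factorization_system
  unfolding factorization_system_def closed_under_comp_def by (auto dest!: HomD)

text \<open>Both \<open>k\<close> and \<open>l\<close> are fill-ins of the square with top
  \<open>k \<cdot> e\<close> and bottom \<open>m \<cdot> k\<close>.\<close>

lemma diagonal_unique:
  assumes "e \<in> final C" "m \<in> dfib C" "e \<in> Hom C a b" "m \<in> Hom C c d"
    and k: "k \<in> Hom C b c" and l: "l \<in> Hom C b c" and "k \<cdot> e = l \<cdot> e" "m \<cdot> k = m \<cdot> l"
  shows "k = l"
proof -
  have "m \<cdot> (k \<cdot> e) = (m \<cdot> k) \<cdot> e"
    using assoc[OF assms(3) k assms(4)] by simp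
  from diagonal[OF assms(1-4) comp_hom[OF assms(3) k] comp_hom[OF k assms(4)] this]
  show ?thesis
    using k l assms(7,8) by auto
qed

lemma arrow_map_invertible:
  assumes f: "f \<in> Hom C X Y" "f \<in> dfib C" and x: "x \<in> points C X"
  obtains d where "d \<in> Hom C (slice C (f \<cdot> x)) (slice C x)"
    "d \<cdot> arrow_map C f x = Idt C (slice C x)"
    "arrow_map C f x \<cdot> d = Idt C (slice C (f \<cdot> x))"
proof -
  define e where "e = arrow_map C f x"
  note p = point_parts[OF x] and q = point_parts[OF comp_point[OF f(1) x]]
  have e: "e \<in> Hom C (slice C x) (slice C (f \<cdot> x))"
    "mpart C (f \<cdot> x) \<cdot> e = f \<cdot> mpart C x" "e \<cdot> epart C x = epart C (f \<cdot> x)"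
    using arrow_map[OF f(1) x] unfolding e_def by auto
  have m: "f \<cdot> mpart C x \<in> dfib C" "f \<cdot> mpart C x \<in> Hom C (slice C x) Y"
    using dfib_comp[OF p(3) f(2) p(4) f(1)] comp_hom[OF p(4) f(1)] by auto
  have sq: "(f \<cdot> mpart C x) \<cdot> epart C x = mpart C (f \<cdot> x) \<cdot> epart C (f \<cdot> x)"
    using assoc[OF p(2,4) f(1)] p(5) q(5) by simp
  \<comment> \<open>The candidate inverse is the fill-in of e_fx against
    \<open>f \<cdot> mpart C x\<close>, which compares the two factorizations of fx in the direction
    opposite to the arrow map.\<close>
  obtain d where d: "d \<in> Hom C (slice C (f \<cdot> x)) (slice C x)"
    "d \<cdot> epart C (f \<cdot> x) = epart C x" "(f \<cdot> mpart C x) \<cdot> d = mpart C (f \<cdot> x)"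
    using diagonal[OF q(1) m(1) q(2) m(2) p(2) q(4) sq] by blast
  have s: "slice C x \<in> Ob C" "slice C (f \<cdot> x) \<in> Ob C"
    using dom_ob_Hom p(4) q(4) by auto
  \<comment> \<open>Both \<open>d \<cdot> e\<close> and the identity fill the square of e_x against
    \<open>f \<cdot> mpart C x\<close>; below, \<open>e \<cdot> d\<close> and the identity fill that
    of e_fx against \<open>mpart C (f \<cdot> x)\<close>.\<close>
  have "d \<cdot> e \<in> Hom C (slice C x) (slice C x)" "(d \<cdot> e) \<cdot> epart C x = epart C x"
    "(f \<cdot> mpart C x) \<cdot> (d \<cdot> e) = f \<cdot> mpart C x"
    using comp_hom[OF e(1) d(1)] assoc[OF p(2) e(1) d(1)] assoc[OF e(1) d(1) m(2), symmetric]
      e d by simp_all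
  then have "d \<cdot> e = Idt C (slice C x)"
    using diagonal_unique[OF p(1) m(1) p(2) m(2) _ id_hom[OF s(1)]] id_left[OF p(2)]
      id_right[OF m(2)] by simp
  moreover have "e \<cdot> d \<in> Hom C (slice C (f \<cdot> x)) (slice C (f \<cdot> x))"
    "(e \<cdot> d) \<cdot> epart C (f \<cdot> x) = epart C (f \<cdot> x)" "mpart C (f \<cdot> x) \<cdot> (e \<cdot> d) = mpart C (f \<cdot> x)"
    using comp_hom[OF d(1) e(1)] assoc[OF q(2) d(1) e(1)] assoc[OF d(1) e(1) q(4), symmetric]
      e d by simp_all
  then have "e \<cdot> d = Idt C (slice C (f \<cdot> x))"
    using diagonal_unique[OF q(1) q(3) q(2) q(4) _ id_hom[OF s(2)]] id_left[OF q(2)]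
      id_right[OF q(4)] by simp
  ultimately show thesis
    using that d(1) unfolding e_def by blast
qed

text \<open>On arrows with target \<open>x\<close> the functor is composition with the arrow map of
  \<open>f\<close> at \<open>x\<close>. This map has an inverse \<open>d\<close>, so the only lift
  of \<beta> is \<open>d \<cdot> \<beta>\<close>.\<close>

lemma discrete_fibration_underlying:
  assumes f: "f \<in> Hom C X Y" "f \<in> dfib C"
  shows "discrete_fibration (underlying C X) (underlying C Y) (underlying_functor C f)"
  unfolding discrete_fibration_def
proof (intro conjI ballI impI)
  show "is_functor (underlying C X) (underlying C Y) (underlying_functor C f)"
    by (rule is_functor_underlying[OF f(1)])
next
  fix x g assume "x \<in> Ob (underlying C X)" and g: "g \<in> Ar (underlying C Y)"
    and cod: "Cod (underlying C Y) g = fob (underlying_functor C f) x"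
  then have x: "x \<in> points C X"
    by (simp add: underlying_def)
  obtain y \<beta> where g_eq: "g = (y, \<beta>, f \<cdot> x)" and \<beta>: "\<beta> \<in> Hom C (trm C) (slice C (f \<cdot> x))"
    "mpart C (f \<cdot> x) \<cdot> \<beta> = y"
    using g cod by (auto simp: underlying_def underlying_functor_def arrows_def points_def)
  obtain d where d: "d \<in> Hom C (slice C (f \<cdot> x)) (slice C x)"
    "d \<cdot> arrow_map C f x = Idt C (slice C x)" "arrow_map C f x \<cdot> d = Idt C (slice C (f \<cdot> x))"
    by (rule arrow_map_invertible[OF f x])
  note p = point_parts(4)[OF x] and q = point_parts(4)[OF comp_point[OF f(1) x]]
  note e = arrow_map(2,3)[OF f(1) x]
  have \<alpha>: "d \<cdot> \<beta> \<in> Hom C (trm C) (slice C x)" "arrow_map C f x \<cdot> (d \<cdot> \<beta>) = \<beta>"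
    using comp_hom[OF \<beta>(1) d(1)] assoc[OF \<beta>(1) d(1) e(1)] d(3) id_left[OF \<beta>(1)] by auto
  \<comment> \<open>An arrow determines its source, so the source of the lift has to be this point;
    the arrow map lies over \<open>f\<close>, which gives its image as
    \<open>mpart C (f \<cdot> x) \<cdot> \<beta>\<close>, that is \<open>y\<close>.\<close>
  have x': "mpart C x \<cdot> (d \<cdot> \<beta>) \<in> points C X" "f \<cdot> (mpart C x \<cdot> (d \<cdot> \<beta>)) = y"
    using comp_hom[OF \<alpha>(1) p] assoc[OF \<alpha>(1) p f(1)] assoc[OF \<alpha>(1) e(1) q] e(2) \<alpha>(2) \<beta>(2)
    by (auto simp: points_def)
  show "\<exists>!h. h \<in> Ar (underlying C X) \<and> Cod (underlying C X) h = x
      \<and> far (underlying_functor C f) h = g"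
  proof (rule ex1I[of _ "(mpart C x \<cdot> (d \<cdot> \<beta>), d \<cdot> \<beta>, x)"])
    show "(mpart C x \<cdot> (d \<cdot> \<beta>), d \<cdot> \<beta>, x) \<in> Ar (underlying C X)
      \<and> Cod (underlying C X) (mpart C x \<cdot> (d \<cdot> \<beta>), d \<cdot> \<beta>, x) = x
      \<and> far (underlying_functor C f) (mpart C x \<cdot> (d \<cdot> \<beta>), d \<cdot> \<beta>, x) = g"
      using x x' \<alpha>
      by (simp add: underlying_def underlying_functor_def arrows_def points_def g_eq)
  next
    fix h assume "h \<in> Ar (underlying C X) \<and> Cod (underlying C X) h = x
      \<and> far (underlying_functor C f) h = g"
    then obtain z \<alpha> where h: "h = (z, \<alpha>, x)" "\<alpha> \<in> Hom C (trm C) (slice C x)"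
      "mpart C x \<cdot> \<alpha> = z" "arrow_map C f x \<cdot> \<alpha> = \<beta>"
      by (auto simp: underlying_def underlying_functor_def arrows_def points_def g_eq)
    have "d \<cdot> \<beta> = \<alpha>"
      using assoc[OF h(2) e(1) d(1)] d(2) id_left[OF h(2)] h(4) by simp
    with h show "h = (mpart C x \<cdot> (d \<cdot> \<beta>), d \<cdot> \<beta>, x)"
      by simp
  qed
qed

section \<open>Internal sets and the terminal object\<close>

lemma trm_ob: "trm C \<in> Ob C"
  using trm by (simp add: terminal_object_def)

lemma to_trm_unique: "f \<in> Hom C a (trm C) \<Longrightarrow> g \<in> Hom C a (trm C) \<Longrightarrow> f = g"
  using trm dom_ob_Hom[of f] unfolding terminal_object_def by blast

text \<open>The map \<open>t\<close> from S/y to 1 is a composite of discrete fibrations. Hence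
  \<open>epart C y \<cdot> t\<close> and the identity both fill the square of e_y against
  \<open>t\<close>, and are equal. Composing with \<alpha> gives the claim, because
  \<open>t \<cdot> \<alpha>\<close> is the identity of 1.\<close>

lemma internal_set_slice_point:
  assumes "internal_set C S" and y: "y \<in> points C S"
    and \<alpha>: "\<alpha> \<in> Hom C (trm C) (slice C y)"
  shows "\<alpha> = epart C y"
proof -
  obtain s where s: "s \<in> Hom C S (trm C)" "s \<in> dfib C"
    using assms(1) by (auto simp: internal_set_def)
  note p = point_parts[OF y]
  define t where "t = s \<cdot> mpart C y"
  have t: "t \<in> dfib C" "t \<in> Hom C (slice C y) (trm C)"
    using dfib_comp[OF p(3) s(2) p(4) s(1)] comp_hom[OF p(4) s(1)] unfolding t_def by auto
  have id: "g = Idt C (trm C)" if "g \<in> Hom C (trm C) (trm C)" for g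
    using to_trm_unique[OF that id_hom[OF trm_ob]] .
  have S: "slice C y \<in> Ob C"
    using dom_ob_Hom[OF p(4)] .
  have et: "epart C y \<cdot> t \<in> Hom C (slice C y) (slice C y)"
    by (rule comp_hom[OF t(2) p(2)])
  have "(epart C y \<cdot> t) \<cdot> epart C y = epart C y" "t \<cdot> (epart C y \<cdot> t) = t"
    using assoc[OF p(2) t(2) p(2)] id[OF comp_hom[OF p(2) t(2)]] id_right[OF p(2)]
      to_trm_unique[OF comp_hom[OF et t(2)] t(2)] by simp_all
  then have "epart C y \<cdot> t = Idt C (slice C y)"
    using diagonal_unique[OF p(1) t(1) p(2) t(2) et id_hom[OF S]] id_left[OF p(2)]
      id_right[OF t(2)] by simp
  then show ?thesis
    using assoc[OF \<alpha> t(2) p(2)] id[OF comp_hom[OF \<alpha> t(2)]] id_left[OF \<alpha>] id_right[OF p(2)] by simp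
qed

lemma discrete_category_underlying:
  assumes "internal_set C S"
  shows "discrete_category (underlying C S)"
  unfolding discrete_category_def
proof (intro conjI ballI category_underlying)
  fix a assume "a \<in> Ar (underlying C S)"
  then obtain x \<alpha> y where a: "a = (x, \<alpha>, y)" and y: "y \<in> points C S"
    and \<alpha>: "\<alpha> \<in> Hom C (trm C) (slice C y)" "mpart C y \<cdot> \<alpha> = x"
    by (auto simp: underlying_def arrows_def points_def)
  \<comment> \<open>With \<alpha> equal to e_y, the source is
    \<open>mpart C y \<cdot> epart C y\<close>, which is \<open>y\<close>; so the source component
    agrees as well.\<close>
  have "a = Idt (underlying C S) y"
    using internal_set_slice_point[OF assms y \<alpha>(1)] point_parts(5)[OF y] \<alpha>(2) a
    by (simp add: underlying_def)
  with y show "\<exists>x \<in> Ob (underlying C S). a = Idt (underlying C S) x"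
    by (auto simp: underlying_def)
qed

text \<open>The identity of 1 is an isomorphism, hence a discrete fibration. This makes the terminal
  object a special case of the result on sets.\<close>

lemma internal_set_trm: "internal_set C (trm C)"
proof -
  note i = id_hom[OF trm_ob]
  have "Idt C (trm C) \<in> isomorphisms C"
    using i id_left[OF i] HomD[OF i] by (auto simp: isomorphisms_def)
  then show ?thesis
    using i trm_ob factorization_system
    unfolding internal_set_def factorization_system_def by blast
qed

text \<open>The identity is the only point of 1, and all arrows are identities by
  discreteness.\<close>

lemma terminal_category_underlying: "terminal_category (underlying C (trm C))"
proof -
  have ob: "Ob (underlying C (trm C)) = {Idt C (trm C)}"
    using to_trm_unique id_hom[OF trm_ob] by (auto simp: underlying_def points_def)
  interpret U: category "underlying C (trm C)" by (rule category_underlying)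
  have "Idt (underlying C (trm C)) (Idt C (trm C)) \<in> Ar (underlying C (trm C))"
    using HomD[OF U.id_hom] ob by blast
  moreover have "f = Idt (underlying C (trm C)) (Idt C (trm C))"
    if "f \<in> Ar (underlying C (trm C))" for f
    using discrete_category_underlying[OF internal_set_trm] that
    unfolding discrete_category_def ob by blast
  ultimately have "\<exists>!f. f \<in> Ar (underlying C (trm C))"
    by blast
  with ob show ?thesis
    by (simp add: terminal_category_def category_underlying)
qed

section \<open>The comparison of internal and ordinary slices\<close>

definition slice_comparison ::
  "'m \<Rightarrow> ('m, 'm \<times> 'm \<times> 'm, 'm \<times> 'm \<times> 'm,
     ('m \<times> 'm \<times> 'm) \<times> ('m \<times> 'm \<times> 'm) \<times> ('m \<times> 'm \<times> 'm)) cat_functor" where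
  "slice_comparison x =
     \<lparr>fob = (\<lambda>p. (mpart C x \<cdot> p, p, x)),
      far = (\<lambda>(p, \<alpha>, q). ((mpart C x \<cdot> p, p, x),
        far (underlying_functor C (mpart C x)) (p, \<alpha>, q), (mpart C x \<cdot> q, q, x)))\<rparr>"

text \<open>Both sides map (X/x)/q to X/x, restrict to \<open>q\<close> along e_q and agree after
  \<open>mpart C x\<close>, so they are the same fill-in of e_q against
  \<open>mpart C x\<close>.\<close>

lemma hat_arrow_map_mpart:
  assumes x: "x \<in> points C X" and q: "q \<in> points C (slice C x)"
  shows "hat C (mpart C x \<cdot> q) q x \<cdot> arrow_map C (mpart C x) q = mpart C q"
    and "hat C (mpart C x \<cdot> q) q x \<in> Hom C (slice C (mpart C x \<cdot> q)) (slice C x)"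
proof -
  note p = point_parts[OF x] and pq = point_parts[OF q]
  note xq = comp_point[OF p(4) q]
  note r = point_parts[OF xq]
  \<comment> \<open>The point \<open>q\<close> of X/x is now read as an arrow of X into
    \<open>x\<close>, so that \<open>hat\<close> applies to it.\<close>
  have "q \<in> arrows C (mpart C x \<cdot> q) x"
    using q by (simp add: arrows_def)
  note h = hat[OF xq x this] and e = arrow_map[OF p(4) q]
  show "hat C (mpart C x \<cdot> q) q x \<in> Hom C (slice C (mpart C x \<cdot> q)) (slice C x)"
    by (rule h(1))
  define k where "k = hat C (mpart C x \<cdot> q) q x \<cdot> arrow_map C (mpart C x) q"
  have k: "k \<in> Hom C (slice C q) (slice C x)" "k \<cdot> epart C q = q"
    "mpart C x \<cdot> k = mpart C x \<cdot> mpart C q"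
    using comp_hom[OF e(2) h(1)] assoc[OF pq(2) e(2) h(1)] assoc[OF e(2) h(1) p(4)] h e
    unfolding k_def by simp_all
  have "k = mpart C q"
    using diagonal_unique[OF pq(1) p(3) pq(2) p(4) k(1) pq(4)] k pq(5) by simp
  then show "hat C (mpart C x \<cdot> q) q x \<cdot> arrow_map C (mpart C x) q = mpart C q"
    unfolding k_def .
qed

text \<open>This is what makes the image of an arrow a map over \<open>x\<close>. The composite is
  \<open>hat\<close> of \<open>q\<close> after the arrow map after \<alpha>, which collapses to
  \<open>mpart C q \<cdot> \<alpha>\<close>, that is \<open>p\<close>.\<close>

lemma slice_comparison_triangle:
  assumes x: "x \<in> points C X" and a: "a \<in> Hom (underlying C (slice C x)) p q"
  shows "fob (slice_comparison x) q \<cdot>\<^bsub>underlying C X\<^esub> far (underlying_functor C (mpart C x)) a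
    = fob (slice_comparison x) p"
proof -
  obtain \<alpha> where q: "q \<in> points C (slice C x)" and a_eq: "a = (p, \<alpha>, q)"
    and \<alpha>: "\<alpha> \<in> Hom C (trm C) (slice C q)" "mpart C q \<cdot> \<alpha> = p"
    using a unfolding Hom_underlying by (auto simp: arrows_def points_def)
  note h = hat_arrow_map_mpart[OF x q]
  show ?thesis
    using assoc[OF \<alpha>(1) arrow_map(2)[OF point_parts(4)[OF x] q] h(2)] h(1) \<alpha>(2)
    by (simp add: slice_comparison_def underlying_functor_def underlying_def a_eq)
qed

text \<open>A map \<open>p\<close> from 1 to X/x is the same thing as an arrow into \<open>x\<close>
  with source \<open>mpart C x \<cdot> p\<close>; the triple only records both ends.\<close>

lemma Ob_slice_underlying:
  assumes x: "x \<in> points C X"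
  shows "Ob (slice_category (underlying C X) x)
    = fob (slice_comparison x) ` Ob (underlying C (slice C x))"
  using x comp_point[OF point_parts(4)[OF x]]
  by (auto simp: slice_category_def slice_comparison_def underlying_def arrows_def)

lemma far_slice_comparison:
  "a \<in> Hom (underlying C X) p q \<Longrightarrow> far (slice_comparison x) a
     = (fob (slice_comparison x) p, far (underlying_functor C (mpart C x)) a,
        fob (slice_comparison x) q)"
  by (auto simp: Hom_underlying slice_comparison_def)

lemma slice_comparison_hom:
  assumes x: "x \<in> points C X" and a: "a \<in> Hom (underlying C (slice C x)) p q"
  shows "far (slice_comparison x) a \<in> Hom (slice_category (underlying C X) x)
    (fob (slice_comparison x) p) (fob (slice_comparison x) q)"
proof -
  interpret U: category "underlying C X" by (rule category_underlying)
  interpret F: is_functor "underlying C (slice C x)" "underlying C X"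
      "underlying_functor C (mpart C x)"
    by (rule is_functor_underlying[OF point_parts(4)[OF x]])
  have pq: "p \<in> Ob (underlying C (slice C x))" "q \<in> Ob (underlying C (slice C x))"
    using a unfolding Hom_underlying by (auto simp: underlying_def)
  have "fob (slice_comparison x) r
      \<in> Hom (underlying C X) (Dom (underlying C X) (fob (slice_comparison x) r)) x"
    and "Dom (underlying C X) (fob (slice_comparison x) r)
      = fob (underlying_functor C (mpart C x)) r"
    if "r \<in> Ob (underlying C (slice C x))" for r
    using x that comp_point[OF point_parts(4)[OF x]]
    by (auto simp: Hom_def slice_comparison_def underlying_functor_def underlying_def
        arrows_def)
  then show ?thesis
    unfolding U.Hom_slice_category far_slice_comparison[OF a]
    using pq F.far_hom[OF a] slice_comparison_triangle[OF x a] by simp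
qed

text \<open>Composition in the slice happens in the middle component, where the functor laws of
  \<open>underlying_functor C (mpart C x)\<close> apply.\<close>

lemma is_functor_slice_comparison:
  assumes x: "x \<in> points C X"
  shows "is_functor (underlying C (slice C x)) (slice_category (underlying C X) x)
    (slice_comparison x)"
proof -
  interpret U: category "underlying C X" by (rule category_underlying)
  interpret S: category "slice_category (underlying C X) x" by (rule U.category_slice_category)
  interpret F: is_functor "underlying C (slice C x)" "underlying C X"
      "underlying_functor C (mpart C x)"
    by (rule is_functor_underlying[OF point_parts(4)[OF x]])
  show ?thesis
  proof
    fix p assume p: "p \<in> Ob (underlying C (slice C x))"
    then show "fob (slice_comparison x) p \<in> Ob (slice_category (underlying C X) x)"
      using Ob_slice_underlying[OF x] by blast
    show "far (slice_comparison x) (Idt (underlying C (slice C x)) p)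
        = Idt (slice_category (underlying C X) x) (fob (slice_comparison x) p)"
      using F.far_id[OF p] far_slice_comparison[OF F.dom.id_hom[OF p]]
      by (simp add: slice_category_def slice_comparison_def underlying_def
          underlying_functor_def)
  next
    fix a p q assume "a \<in> Hom (underlying C (slice C x)) p q"
    then show "far (slice_comparison x) a \<in> Hom (slice_category (underlying C X) x)
        (fob (slice_comparison x) p) (fob (slice_comparison x) q)"
      by (rule slice_comparison_hom[OF x])
  next
    fix a b p q r assume a: "a \<in> Hom (underlying C (slice C x)) p q"
      and b: "b \<in> Hom (underlying C (slice C x)) q r"
    show "far (slice_comparison x) (b \<cdot>\<^bsub>underlying C (slice C x)\<^esub> a)
        = far (slice_comparison x) b \<cdot>\<^bsub>slice_category (underlying C X) x\<^esub>
          far (slice_comparison x) a"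
      unfolding far_slice_comparison[OF a] far_slice_comparison[OF b]
        far_slice_comparison[OF F.dom.comp_hom[OF a b]] F.far_comp[OF a b]
      by (simp add: slice_category_def)
  qed
qed

text \<open>On objects, \<open>p\<close> is read off from its triple. On arrows, the functor induced
  by \<open>mpart C x\<close> is a discrete fibration: uniqueness of lifts yields injectivity and
  existence yields surjectivity.\<close>

lemma category_isomorphism_slice_comparison:
  assumes x: "x \<in> points C X"
  shows "category_isomorphism (underlying C (slice C x)) (slice_category (underlying C X) x)
    (slice_comparison x)"
proof (rule category_isomorphism_if_bij[OF is_functor_slice_comparison[OF x]])
  have inj: "fob (slice_comparison x) p = fob (slice_comparison x) q \<longleftrightarrow> p = q" for p q
    by (auto simp: slice_comparison_def)
  show "bij_betw (fob (slice_comparison x)) (Ob (underlying C (slice C x)))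
      (Ob (slice_category (underlying C X) x))"
    using Ob_slice_underlying[OF x] inj by (simp add: bij_betw_def inj_on_def)
  interpret F: is_functor "underlying C (slice C x)" "underlying C X"
      "underlying_functor C (mpart C x)"
    by (rule is_functor_underlying[OF point_parts(4)[OF x]])
  have lift: "\<exists>!h. h \<in> Ar (underlying C (slice C x)) \<and> Cod (underlying C (slice C x)) h = q
      \<and> far (underlying_functor C (mpart C x)) h = g"
    if "q \<in> Ob (underlying C (slice C x))" "g \<in> Ar (underlying C X)"
      "Cod (underlying C X) g = fob (underlying_functor C (mpart C x)) q" for q g
    using discrete_fibration_underlying[OF point_parts(4,3)[OF x]] that
    unfolding discrete_fibration_def by blast
  have hom: "a \<in> Hom (underlying C (slice C x)) (Dom (underlying C (slice C x)) a)
      (Cod (underlying C (slice C x)) a)" if "a \<in> Ar (underlying C (slice C x))" for a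
    using that by (simp add: Hom_def)
  have "inj_on (far (slice_comparison x)) (Ar (underlying C (slice C x)))"
  proof (rule inj_onI)
    fix a b assume a: "a \<in> Ar (underlying C (slice C x))" and b: "b \<in> Ar (underlying C (slice C x))"
      and "far (slice_comparison x) a = far (slice_comparison x) b"
    \<comment> \<open>Equal triples have equal third components, so \<open>a\<close> and
      \<open>b\<close> have the same target and are lifts of one arrow.\<close>
    then have "far (underlying_functor C (mpart C x)) a = far (underlying_functor C (mpart C x)) b"
      "Cod (underlying C (slice C x)) a = Cod (underlying C (slice C x)) b"
      using inj unfolding far_slice_comparison[OF hom[OF a]] far_slice_comparison[OF hom[OF b]]
      by auto
    then show "a = b"
      using lift[OF F.dom.cod_ob[OF b]] a b HomD[OF F.far_hom[OF hom[OF b]]] by blast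
  qed
  moreover have "t \<in> far (slice_comparison x) ` Ar (underlying C (slice C x))"
    if t: "t \<in> Ar (slice_category (underlying C X) x)" for t
  proof -
    obtain g h k where t_eq: "t = (g, h, k)" and g: "g \<in> Ob (slice_category (underlying C X) x)"
      and k: "k \<in> Ob (slice_category (underlying C X) x)"
      and h: "h \<in> Hom (underlying C X) (Dom (underlying C X) g) (Dom (underlying C X) k)"
      "k \<cdot>\<^bsub>underlying C X\<^esub> h = g"
      using t by (auto simp: slice_category_def)
    obtain q where q: "q \<in> Ob (underlying C (slice C x))" "k = fob (slice_comparison x) q"
      using k unfolding Ob_slice_underlying[OF x] by blast
    have "Cod (underlying C X) h = fob (underlying_functor C (mpart C x)) q"
      using HomD[OF h(1)] q(2)
      by (simp add: slice_comparison_def underlying_def underlying_functor_def)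
    then obtain a where a: "a \<in> Ar (underlying C (slice C x))"
      "Cod (underlying C (slice C x)) a = q" "far (underlying_functor C (mpart C x)) a = h"
      using lift[OF q(1)] HomD[OF h(1)] by blast
    \<comment> \<open>The lift was chosen to match \<open>h\<close> and \<open>k\<close>; the first
      component matches too, since the triangle makes it the composite of \<open>k\<close> and
      \<open>h\<close>, which is \<open>g\<close>.\<close>
    have "far (slice_comparison x) a = t"
      using far_slice_comparison[OF hom[OF a(1)]] slice_comparison_triangle[OF x hom[OF a(1)]]
        a q(2) h(2) t_eq by simp
    with a(1) show ?thesis
      by blast
  qed
  moreover have "far (slice_comparison x) a \<in> Ar (slice_category (underlying C X) x)"
    if "a \<in> Ar (underlying C (slice C x))" for a
    using HomD[OF slice_comparison_hom[OF x hom[OF that]]] by blast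
  ultimately show "bij_betw (far (slice_comparison x)) (Ar (underlying C (slice C x)))
      (Ar (slice_category (underlying C X) x))"
    unfolding bij_betw_def by blast
qed

text \<open>Immediate from the definitions for any \<open>S\<close>; with \<open>slice C x\<close>
  for \<open>S\<close> it says that the comparison lies over the underlying category of X.\<close>

lemma slice_projection_slice_comparison:
  "functor_eq (underlying C S)
    (functor_comp (slice_projection (underlying C X)) (slice_comparison x))
    (underlying_functor C (mpart C x))"
  by (auto simp: functor_eq_def functor_comp_def slice_projection_def slice_comparison_def
      underlying_functor_def underlying_def)

end

theorem proposition3p10:
  fixes C :: "('o, 'm, 'z) fcat_scheme"
  assumes "fc_category C"
  shows "terminal_category (underlying C (trm C))
    \<and> (\<forall>S. internal_set C S \<longrightarrow> discrete_category (underlying C S))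
    \<and> (\<forall>X \<in> Ob C. \<forall>x \<in> points C X.
         \<exists>\<Phi>. category_isomorphism (underlying C (slice C x)) (slice_category (underlying C X) x) \<Phi>
           \<and> functor_eq (underlying C (slice C x))
               (functor_comp (slice_projection (underlying C X)) \<Phi>)
               (underlying_functor C (mpart C x)))
    \<and> (\<forall>X \<in> Ob C. \<forall>Y \<in> Ob C. \<forall>f \<in> Hom C X Y. f \<in> dfib C
         \<longrightarrow> discrete_fibration (underlying C X) (underlying C Y) (underlying_functor C f))"
proof -
  interpret fc_category C by (rule assms)
  show ?thesis
    using terminal_category_underlying discrete_category_underlying
      category_isomorphism_slice_comparison slice_projection_slice_comparison
      discrete_fibration_underlying by blast
qed

end
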